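(* Let $L$ and $B$ be matrix ordinary differential operators in $\mathcal{R}_\ell[D]$, and assume that $L=A_0+A_1D$ has order one with invertible leading coefficient $A_1$. If $L$ and $B$ commute, then the differential resultant $$f(\lambda,\mu)=\mathrm{DRes}(L-\lambda,B-\mu)$$ is a polynomial in $C[\lambda,\mu]$.
   Context: $K$ is a differential field with derivation $\partial$ (write $a'=\partial(a)$) whose field of constants $C$ is algebraically closed of characteristic zero. $\mathcal{R}_\ell=M_\ell(K)$, with entrywise derivation $D(A)=A'$. $\mathcal{R}_\ell[D]$ is the ring of matrix ordinary differential operators $\sum_j B_jD^j$, $B_j\in\mathcal{R}_\ell$, with commutation rule $DA=AD+A'$. $\lambda,\mu$ are algebraic variables over $K$ with $\partial\lambda=\partial\mu=0$, so $\partial$ extends to $K[\lambda,\mu]$ and $K(\lambda,\mu)$. $L-\lambda$ and $B-\mu$ denote $L-\lambda I_\ell$ and $B-\mu I_\ell$ in $M_\ell(K(\lambda,\mu))[D]$. For $L=A_0+A_1D$ with $A_1$ invertible and $B=\sum_{j=0}^nB_jD^j$, $n\ge1$, put $N_\lambda=-A_1^{-1}(A_0-\lambda I_\ell)$, $p_0(N_\lambda)=I_\ell$, $p_j(N_\lambda)=p_{j-1}(N_\lambda)N_\lambda+(p_{j-1}(N_\lambda))'$ for $j\ge1$, $M(L-\lambda,B-\mu)=B_0-\mu I_\ell+\sum_{j=1}^nB_jp_j(N_\lambda)$, and $\mathrm{DRes}(L-\lambda,B-\mu)=\det M(L-\lambda,B-\mu)$, which a priori lies in $K[\lambda,\mu]$.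 *)

theory Defs
  imports "HOL-Analysis.Analysis" "HOL-Computational_Algebra.Polynomial"
begin

definition derivation :: "('a::comm_ring_1 \<Rightarrow> 'a) \<Rightarrow> bool" where
  "derivation d \<longleftrightarrow> (\<forall>a b. d (a + b) = d a + d b) \<and> (\<forall>a b. d (a * b) = d a * b + a * d b)"

definition constants :: "('a::comm_ring_1 \<Rightarrow> 'a) \<Rightarrow> 'a set" where
  "constants d = {a. d a = 0}"

definition polys_over :: "'a::zero set \<Rightarrow> 'a poly set" where
  "polys_over C = {p. \<forall>i. coeff p i \<in> C}"

definition algebraically_closed_subfield :: "'a::field set \<Rightarrow> bool" where
  "algebraically_closed_subfield C \<longleftrightarrow>
     0 \<in> C \<and> 1 \<in> C \<and>
     (\<forall>a\<in>C. \<forall>b\<in>C. a - b \<in> C \<and> a * b \<in> C) \<and> (\<forall>a\<in>C. inverse a \<in> C) \<and>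
     (\<forall>p\<in>polys_over C. degree p > 0 \<longrightarrow> (\<exists>x\<in>C. poly p x = 0))"

text \<open>
  An operator \<open>\<Sum>j. B\<^sub>j D\<^sup>j\<close> with matrix coefficients over a differential ring is represented by
  the finitely supported sequence of its left coefficients, using the type \<open>('a^'n^'n) poly\<close> for
  its additive structure only. The multiplication of type \<open>poly\<close> is not used: it is built on the
  componentwise product of matrices and has no derivation term. The product is
  \<open>op_mult\<close>, determined by left linearity over the matrices and
  \<open>D (\<Sum>j. B\<^sub>j D\<^sup>j) = \<Sum>j. (B\<^sub>j D\<^sup>j\<^sup>+\<^sup>1 + B\<^sub>j' D\<^sup>j)\<close>.
\<close>

type_synonym ('a, 'n) matrix_op = "('a^'n^'n) poly"

definition D_times :: "('a::comm_ring_1 \<Rightarrow> 'a) \<Rightarrow> ('a, 'n::finite) matrix_op \<Rightarrow> ('a, 'n) matrix_op" where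
  "D_times d Q = pCons 0 Q + map_poly (map_matrix d) Q"

definition op_mult :: "('a::comm_ring_1 \<Rightarrow> 'a) \<Rightarrow> ('a, 'n::finite) matrix_op \<Rightarrow> ('a, 'n) matrix_op
    \<Rightarrow> ('a, 'n) matrix_op" where
  "op_mult d P Q = (\<Sum>i\<le>degree P. map_poly (\<lambda>B. coeff P i ** B) ((D_times d ^^ i) Q))"

text \<open>The commutation rule \<open>D A = A D + A'\<close>.\<close>

lemma D_op_mult_matrix:
  fixes A :: "'a::comm_ring_1^'n^'n"
  assumes "derivation d"
  shows "op_mult d [:0, mat 1:] [:A:] = [:map_matrix d A, A:]"
proof -
  have d0: "d 0 = 0"
    using assms unfolding derivation_def by (metis add_cancel_right_left)
  have [simp]: "map_matrix d (0::'a^'n^'n) = 0"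
    by (simp add: vec_eq_iff d0)
  have nz: "(mat 1 :: 'a^'n^'n) \<noteq> 0"
    by (auto simp: vec_eq_iff mat_def)
  have 1: "map_poly (\<lambda>B::'a^'n^'n. 0 ** B) Q = 0" for Q :: "('a^'n^'n) poly"
    by (rule poly_eqI) (simp add: coeff_map_poly)
  have 2: "map_poly (\<lambda>B::'a^'n^'n. mat 1 ** B) Q = Q" for Q :: "('a^'n^'n) poly"
    by (rule poly_eqI) (simp add: coeff_map_poly)
  show ?thesis
    by (rule poly_eqI)
      (simp add: op_mult_def D_times_def nz 1 2 map_poly_pCons coeff_pCons split: nat.split)
qed

primrec red_poly :: "('a::comm_ring_1 \<Rightarrow> 'a) \<Rightarrow> 'a^'n^'n \<Rightarrow> nat \<Rightarrow> 'a^'n::finite^'n" where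
  "red_poly d N 0 = mat 1"
| "red_poly d N (Suc j) = red_poly d N j ** N + map_matrix d (red_poly d N j)"

text \<open>
  Here \<open>P\<close> is meant to be an operator \<open>P\<^sub>0 + P\<^sub>1 D\<close> with \<open>P\<^sub>1\<close> invertible.
\<close>

definition red_matrix :: "('a::comm_ring_1 \<Rightarrow> 'a) \<Rightarrow> ('a, 'n::finite) matrix_op \<Rightarrow> ('a, 'n) matrix_op
    \<Rightarrow> 'a^'n^'n" where
  "red_matrix d P Q =
     (let N = - (matrix_inv (coeff P 1) ** coeff P 0)
      in coeff Q 0 + (\<Sum>j=1..degree Q. coeff Q j ** red_poly d N j))"

definition DRes :: "('a::comm_ring_1 \<Rightarrow> 'a) \<Rightarrow> ('a, 'n::finite) matrix_op \<Rightarrow> ('a, 'n) matrix_op \<Rightarrow> 'a" where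
  "DRes d P Q = det (red_matrix d P Q)"

text \<open>
  \<open>K[\<lambda>, \<mu>]\<close> is the type \<open>'a poly poly\<close>: the inner variable is \<open>\<lambda>\<close>, the outer one \<open>\<mu>\<close>.
\<close>

definition var_lambda :: "'a::comm_ring_1 poly poly" where
  "var_lambda = [:[:0, 1:]:]"

definition var_mu :: "'a::comm_ring_1 poly poly" where
  "var_mu = [:0, 1:]"

definition deriv2 :: "('a::comm_ring_1 \<Rightarrow> 'a) \<Rightarrow> 'a poly poly \<Rightarrow> 'a poly poly" where
  "deriv2 d = map_poly (map_poly d)"

definition const2 :: "'a::comm_ring_1 \<Rightarrow> 'a poly poly" where
  "const2 a = [:[:a:]:]"

definition lift_op :: "('a::comm_ring_1, 'n::finite) matrix_op \<Rightarrow> ('a poly poly, 'n) matrix_op" where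
  "lift_op P = map_poly (map_matrix const2) P"

definition minus_scalar :: "('a::comm_ring_1, 'n::finite) matrix_op \<Rightarrow> 'a poly poly
    \<Rightarrow> ('a poly poly, 'n) matrix_op" where
  "minus_scalar P c = lift_op P - [:mat c:]"

lemma const2_simps:
  "const2 0 = 0" "const2 1 = 1" "const2 (a + b) = const2 a + const2 b"
  "const2 (a * b) = const2 a * const2 b"
  by (simp_all add: const2_def one_pCons)

lemma coeff_minus_scalar:
  fixes P :: "('a::comm_ring_1, 'n::finite) matrix_op"
  shows "coeff (minus_scalar P c) j = map_matrix const2 (coeff P j) - (if j = 0 then mat c else 0)"
proof -
  have "map_matrix const2 (0::'a^'n^'n) = 0"
    by (simp add: vec_eq_iff const2_simps)
  then show ?thesis
    by (simp add: minus_scalar_def lift_op_def coeff_map_poly coeff_pCons split: nat.split)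
qed

lemma matrix_inv_lift:
  fixes A :: "'a::comm_ring_1^'n^'n"
  assumes "invertible A"
  shows "matrix_inv (map_matrix const2 A) = map_matrix const2 (matrix_inv A)"
proof -
  have c_sum: "const2 (sum f S) = (\<Sum>x\<in>S. const2 (f x))" for f :: "'n \<Rightarrow> 'a" and S
    by (induction S rule: infinite_finite_induct) (simp_all add: const2_simps)
  have mult: "map_matrix const2 (X ** Y) = map_matrix const2 X ** map_matrix const2 Y"
    for X Y :: "'a^'n^'n"
    by (simp add: vec_eq_iff matrix_matrix_mult_def c_sum const2_simps)
  have one: "map_matrix const2 (mat 1 :: 'a^'n^'n) = mat 1"
    by (simp add: vec_eq_iff mat_def const2_simps)
  let ?A = "map_matrix const2 A" and ?B = "map_matrix const2 (matrix_inv A)"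
  have "A ** matrix_inv A = mat 1 \<and> matrix_inv A ** A = mat 1"
    using assms unfolding invertible_def matrix_inv_def by (rule someI_ex)
  then have AB: "?A ** ?B = mat 1" "?B ** ?A = mat 1"
    by (simp_all flip: mult add: one)
  then have "invertible ?A"
    unfolding invertible_def by blast
  then have "?A ** matrix_inv ?A = mat 1 \<and> matrix_inv ?A ** ?A = mat 1"
    unfolding invertible_def matrix_inv_def by (rule someI_ex)
  then have "?B ** (?A ** matrix_inv ?A) = ?B"
    by simp
  then show ?thesis
    by (simp add: matrix_mul_assoc AB)
qed

text \<open>The explicit form of \<open>M(L - \<lambda>, B - \<mu>)\<close> for \<open>L = A\<^sub>0 + A\<^sub>1 D\<close>.\<close>

lemma red_matrix_minus_scalar:
  fixes A0 A1 :: "'a::comm_ring_1^'n^'n"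
  assumes "invertible A1"
  defines "N \<equiv> - (map_matrix const2 (matrix_inv A1) ** (map_matrix const2 A0 - mat var_lambda))"
  shows "red_matrix (deriv2 d) (minus_scalar [:A0, A1:] var_lambda) (minus_scalar B var_mu) =
    map_matrix const2 (coeff B 0) - mat var_mu +
    (\<Sum>j=1..degree B. map_matrix const2 (coeff B j) ** red_poly (deriv2 d) N j)"
proof -
  let ?Q = "minus_scalar B var_mu"
  have z: "map_matrix const2 X = 0 \<longleftrightarrow> X = 0" for X :: "'a^'n^'n"
    by (simp add: vec_eq_iff const2_def)
  have c: "coeff ?Q j = map_matrix const2 (coeff B j)" if "j > 0" for j
    using that by (simp add: coeff_minus_scalar)
  have deg: "degree ?Q = degree B"
  proof (rule antisym)
    show "degree ?Q \<le> degree B"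
      by (rule degree_le) (simp add: c z coeff_eq_0)
    show "degree B \<le> degree ?Q"
    proof (cases "degree B = 0")
      case False
      then have "coeff ?Q (degree B) \<noteq> 0"
        by (auto simp: c z)
      then show ?thesis by (rule le_degree)
    qed simp
  qed
  have N: "- (matrix_inv (coeff (minus_scalar [:A0, A1:] var_lambda) 1)
      ** coeff (minus_scalar [:A0, A1:] var_lambda) 0) = N"
    by (simp add: coeff_minus_scalar N_def matrix_inv_lift[OF assms(1)])
  show ?thesis
    unfolding red_matrix_def Let_def N deg
    by (simp add: coeff_minus_scalar)
qed

end

theory Submission
  imports Defs
begin

text \<open>
  Reduction modulo the left ideal generated by \<open>L - \<lambda>\<close> sends \<open>Q = \<Sum>j. Q\<^sub>j D\<^sup>j\<close> to
  \<open>\<rho> Q = \<Sum>j. Q\<^sub>j p\<^sub>j(N)\<close> and turns left multiplication by \<open>D\<close> into \<open>X \<mapsto> X' + X N\<close>.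
  Since \<open>\<rho> L = \<lambda>\<close>, applying \<open>\<rho>\<close> to \<open>L B = B L\<close> gives \<open>(\<rho> B)' = N (\<rho> B) - (\<rho> B) N\<close>, hence the
  Lax equation \<open>M' = N M - M N\<close> for \<open>M = \<rho> B - \<mu>\<close>. The determinant of a solution of a Lax
  equation is constant, because over the dual numbers
  \<open>M + \<epsilon> M' = (1 + \<epsilon> N) M (1 - \<epsilon> N)\<close> and \<open>(1 + \<epsilon> N) (1 - \<epsilon> N) = 1\<close>.
\<close>

section \<open>Derivations and their extension to polynomials in two variables\<close>

lemma derivation_add: "derivation d \<Longrightarrow> d (a + b) = d a + d b"
  and derivation_mult: "derivation d \<Longrightarrow> d (a * b) = d a * b + a * d b"
  by (simp_all add: derivation_def)

lemma derivation_0: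
  assumes "derivation d" shows "d 0 = 0"
  using derivation_add[OF assms, of 0 0] by simp

lemma derivation_1:
  assumes "derivation d" shows "d 1 = 0"
  using derivation_mult[OF assms, of 1 1] by simp

lemma derivation_minus:
  assumes "derivation d" shows "d (- a) = - d a"
  using derivation_add[OF assms, of a "- a"] derivation_0[OF assms]
  by (simp add: eq_neg_iff_add_eq_0 add.commute)

lemma derivation_diff:
  assumes "derivation d" shows "d (a - b) = d a - d b"
  using derivation_add[OF assms, of a "- b"] derivation_minus[OF assms] by simp

lemma derivation_sum:
  assumes "derivation d" shows "d (sum f S) = (\<Sum>x\<in>S. d (f x))"
  by (induction S rule: infinite_finite_induct)
    (simp_all add: derivation_0[OF assms] derivation_add[OF assms])

lemma derivation_map_poly:
  assumes "derivation d" shows "derivation (map_poly d)"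
  unfolding derivation_def
  by (auto intro!: poly_eqI simp: coeff_map_poly coeff_mult derivation_0[OF assms]
      derivation_add[OF assms] derivation_mult[OF assms] derivation_sum[OF assms] sum.distrib)

lemma derivation_deriv2: "derivation d \<Longrightarrow> derivation (deriv2 d)"
  unfolding deriv2_def by (intro derivation_map_poly)

lemma deriv2_const2:
  assumes "derivation d" shows "deriv2 d (const2 a) = const2 (d a)"
  by (simp add: deriv2_def const2_def map_poly_pCons derivation_0[OF assms])

lemma deriv2_var:
  assumes "derivation d"
  shows "deriv2 d var_lambda = 0" "deriv2 d var_mu = 0"
  by (simp_all add: deriv2_def var_lambda_def var_mu_def map_poly_pCons map_poly_1
      derivation_0[OF assms] derivation_1[OF assms] flip: one_pCons)

text \<open>Since \<open>deriv2\<close> acts coefficientwise, the theorem reduces to the vanishing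
  of one derivative.\<close>

lemma deriv2_eq_0_iff:
  assumes "derivation d"
  shows "deriv2 d f = 0 \<longleftrightarrow> f \<in> polys_over (polys_over (constants d))"
  by (simp add: polys_over_def constants_def deriv2_def poly_eq_iff coeff_map_poly
      derivation_0[OF assms])


section \<open>Matrix algebra over a commutative ring, and entrywise derivations\<close>

lemma matrix_add_rdistrib: "(A + B) ** C = A ** C + B ** (C :: 'a::comm_ring_1^'n^'n)"
  by (simp add: matrix_matrix_mult_def vec_eq_iff sum.distrib distrib_right)

lemma matrix_minus_left: "(- A) ** C = - (A ** (C :: 'a::comm_ring_1^'n^'n))"
  by (simp add: matrix_matrix_mult_def vec_eq_iff sum_negf)

lemma matrix_minus_right: "A ** (- C) = - (A ** (C :: 'a::comm_ring_1^'n^'n))"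
  by (simp add: matrix_matrix_mult_def vec_eq_iff sum_negf)

lemma matrix_diff_ldistrib: "A ** (B - C) = A ** B - A ** (C :: 'a::comm_ring_1^'n^'n)"
  using matrix_add_ldistrib[of A B "- C"] by (simp add: matrix_minus_right)

lemma matrix_diff_rdistrib: "(A - B) ** C = A ** C - B ** (C :: 'a::comm_ring_1^'n^'n)"
  using matrix_add_rdistrib[of A "- B" C] by (simp add: matrix_minus_left)

lemma matrix_mul_zero: "0 ** C = (0 :: 'a::comm_ring_1^'n^'n)" "C ** 0 = (0 :: 'a^'n^'n)"
  by (simp_all add: matrix_matrix_mult_def vec_eq_iff)

lemma matrix_sum_ldistrib: "A ** sum f S = (\<Sum>x\<in>S. A ** (f x :: 'a::comm_ring_1^'n^'n))"
  by (induction S rule: infinite_finite_induct) (simp_all add: matrix_mul_zero matrix_add_ldistrib)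

lemma matrix_sum_rdistrib: "sum f S ** A = (\<Sum>x\<in>S. (f x :: 'a::comm_ring_1^'n^'n) ** (A :: 'a^'n^'n))"
  by (induction S rule: infinite_finite_induct) (simp_all add: matrix_mul_zero matrix_add_rdistrib)

lemma mat_matrix_mult: "mat c ** A = (\<chi> i j. (c :: 'a::comm_ring_1) * A $ i $ j)"
  by (simp add: matrix_matrix_mult_def mat_def vec_eq_iff if_distrib if_distribR cong: if_cong)

lemma mat_commute: "mat c ** A = A ** mat (c :: 'a::comm_ring_1)"
  unfolding mat_matrix_mult
  by (simp add: matrix_matrix_mult_def mat_def vec_eq_iff if_distrib mult.commute cong: if_cong)

lemma mat_left_commute: "A ** (mat c ** B) = mat (c :: 'a::comm_ring_1) ** (A ** B)"
  by (simp only: matrix_mul_assoc mat_commute[of c A])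

lemma map_matrix_derivation_diff:
  assumes "derivation d"
  shows "map_matrix d (A - B) = map_matrix d A - map_matrix d B"
  by (simp add: vec_eq_iff derivation_diff[OF assms])

lemma map_matrix_derivation_sum:
  assumes "derivation d"
  shows "map_matrix d (sum f S) = (\<Sum>x\<in>S. map_matrix d (f x))"
  by (simp add: vec_eq_iff derivation_sum[OF assms])

lemma map_matrix_derivation_mult:
  assumes "derivation d"
  shows "map_matrix d (A ** B) = map_matrix d A ** B + A ** map_matrix d B"
  by (simp add: vec_eq_iff matrix_matrix_mult_def derivation_sum[OF assms]
      derivation_mult[OF assms] sum.distrib)

lemma map_matrix_derivation_mat:
  assumes "derivation d" "d c = 0"
  shows "map_matrix d (mat c) = 0"
  by (simp add: vec_eq_iff mat_def assms(2) derivation_0[OF assms(1)])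

subsection \<open>Determinants and Lax equations\<close>

text \<open>Divisibility of a difference by \<open>e\<close> serves as congruence modulo
  \<open>e\<close>, so no quotient ring has to be formed. Here and below: transitivity, and
  compatibility with products, sums and determinants.\<close>

lemma dvd_diff_trans:
  fixes e :: "'a::comm_ring_1"
  assumes "e dvd x - y" "e dvd y - z"
  shows "e dvd x - z"
  using dvd_add[OF assms] by simp

lemma dvd_mult_diff:
  fixes e :: "'a::comm_ring_1"
  assumes "e dvd x - x'" "e dvd y - y'"
  shows "e dvd x * y - x' * y'"
proof -
  have "x * y - x' * y' = x * (y - y') + (x - x') * y'"
    by (simp add: algebra_simps)
  then show ?thesis
    using assms by simp
qed

lemma dvd_prod_diff:
  fixes e :: "'a::comm_ring_1"
  assumes "\<And>x. x \<in> S \<Longrightarrow> e dvd f x - g x"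
  shows "e dvd prod f S - prod g S"
  using assms by (induction S rule: infinite_finite_induct) (simp_all add: dvd_mult_diff)

lemma dvd_sum_diff:
  fixes e :: "'a::comm_ring_1"
  assumes "\<And>x. x \<in> S \<Longrightarrow> e dvd f x - g x"
  shows "e dvd sum f S - sum g S"
  using assms by (simp add: dvd_sum flip: sum_subtractf)

lemma dvd_det_diff:
  fixes e :: "'a::comm_ring_1"
  assumes "\<And>i j. e dvd A $ i $ j - B $ i $ j"
  shows "e dvd det A - det B"
  unfolding det_def by (intro dvd_sum_diff dvd_mult_diff dvd_prod_diff assms) simp

lemma sum_pCons: "(\<Sum>x\<in>S. pCons (f x) (g x)) = pCons (sum f S) (sum g S)"
  by (induction S rule: infinite_finite_induct) simp_all

text \<open>The divisor is the square of the dual-number variable, so congruence modulo it is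
  agreement of the two lowest coefficients.\<close>

lemma eps_square_dvd_iff: "[:0, 0, 1:] dvd p \<longleftrightarrow> coeff p 0 = 0 \<and> coeff p 1 = (0 :: 'a::comm_ring_1)"
proof
  assume "coeff p 0 = 0 \<and> coeff p 1 = 0"
  then obtain q where "p = pCons 0 (pCons 0 q)"
    by (metis coeff_pCons_0 coeff_pCons_Suc One_nat_def pCons_cases)
  then show "[:0, 0, 1:] dvd p"
    by (intro dvdI[of _ _ q]) simp
qed (auto elim!: dvdE)

text \<open>
  The map \<open>a \<mapsto> a + \<epsilon> a'\<close> into the dual numbers is a ring homomorphism; the dual numbers are
  encoded as polynomials in \<open>\<epsilon>\<close> modulo \<open>\<epsilon>\<^sup>2\<close>.
\<close>

lemma eps_prod:
  assumes "derivation d"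
  shows "[:0, 0, 1:] dvd [:prod f S, d (prod f S):] - (\<Prod>x\<in>S. [:f x, d (f x):])"
proof (induction S rule: infinite_finite_induct)
  case (insert x S)
  have "[:0, 0, 1:] dvd [:f x * prod f S, d (f x * prod f S):] - [:f x, d (f x):] * [:prod f S, d (prod f S):]"
    by (simp add: eps_square_dvd_iff derivation_mult[OF assms])
  moreover have "[:0, 0, 1:] dvd [:f x, d (f x):] * [:prod f S, d (prod f S):]
      - [:f x, d (f x):] * (\<Prod>x\<in>S. [:f x, d (f x):])"
    by (intro dvd_mult_diff insert.IH) simp
  ultimately show ?case
    unfolding prod.insert[OF insert.hyps] by (rule dvd_diff_trans)
qed (simp_all add: derivation_1[OF assms] one_pCons)

text \<open>The signs in the Leibniz expansion have derivative zero, so only the products of entries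
  need an argument, which is \<open>eps_prod\<close>.\<close>

lemma eps_det:
  fixes A :: "'a::comm_ring_1^'n^'n"
  assumes "derivation d"
  shows "[:0, 0, 1:] dvd [:det A, d (det A):] - det (map_matrix (\<lambda>a. [:a, d a:]) A)"
proof -
  have c: "d (of_int (sign p)) = 0" for p :: "'n \<Rightarrow> 'n"
    by (simp add: sign_def derivation_1[OF assms] derivation_minus[OF assms])
  have "[:det A, d (det A):] = (\<Sum>p | p permutes UNIV. of_int (sign p) *
      [:(\<Prod>i\<in>UNIV. A $ i $ p i), d (\<Prod>i\<in>UNIV. A $ i $ p i):])"
    by (simp add: det_def derivation_sum[OF assms] derivation_mult[OF assms] c of_int_poly sum_pCons mult.commute)
  also have "[:0, 0, 1:] dvd \<dots> - det (map_matrix (\<lambda>a. [:a, d a:]) A)"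
    unfolding det_def nth_map_matrix
    by (intro dvd_sum_diff dvd_mult_diff eps_prod[OF assms]) simp
  finally show ?thesis .
qed

lemma derivation_det_Lax:
  fixes M N :: "'a::comm_ring_1^'n^'n"
  assumes d: "derivation d" and Lax: "map_matrix d M = N ** M - M ** N"
  shows "d (det M) = 0"
proof -
  \<comment> \<open>With e the dual-number variable, \<open>E A\<close> is e A, \<open>I A\<close>
    is A with constant entries, and \<open>T\<close> is M + e M'.\<close>
  define E :: "'a^'n^'n \<Rightarrow> 'a poly^'n^'n" where "E = map_matrix (\<lambda>a. [:0, a:])"
  define I :: "'a^'n^'n \<Rightarrow> 'a poly^'n^'n" where "I = map_matrix (\<lambda>a. [:a:])"
  define T where "T = map_matrix (\<lambda>a. [:a, d a:]) M"
  have EI: "E A ** I B = E (A ** B)" and IE: "I A ** E B = E (A ** B)"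
    and EE: "E A ** E B = map_matrix (\<lambda>a. [:0, 0, a:]) (A ** B)" for A B
    by (simp_all add: E_def I_def vec_eq_iff matrix_matrix_mult_def sum_pCons mult.commute)
  have T: "T = I M + (E (N ** M) - E (M ** N))"
    using Lax by (simp add: T_def E_def I_def vec_eq_iff)
  \<comment> \<open>Expanding leaves only the error term e^2 N M N, which vanishes modulo
    e^2.\<close>
  have conj: "(mat 1 + E N) ** I M ** (mat 1 - E N) = T - E (N ** M) ** E N"
    by (simp add: T matrix_add_rdistrib matrix_add_ldistrib matrix_diff_ldistrib EI IE)
  have "[:0, 0, 1:] dvd det T - det ((mat 1 + E N) ** I M ** (mat 1 - E N))"
    unfolding conj by (rule dvd_det_diff) (simp add: EE eps_square_dvd_iff)
  moreover have "[:0, 0, 1:] dvd det ((mat 1 + E N) ** I M ** (mat 1 - E N)) - det (I M)"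
  proof -
    \<comment> \<open>Determinants commute, so the two outer factors can be multiplied together
      first; their product is 1 - e^2 N^2.\<close>
    have "det ((mat 1 + E N) ** I M ** (mat 1 - E N)) = det ((mat 1 + E N) ** (mat 1 - E N)) * det (I M)"
      by (simp add: det_mul)
    moreover have "(mat 1 + E N) ** (mat 1 - E N) = mat 1 - E N ** E N"
      by (simp add: matrix_add_rdistrib matrix_diff_ldistrib)
    moreover have "[:0, 0, 1:] dvd det (mat 1 - E N ** E N) - det (mat 1 :: 'a poly^'n^'n)"
      by (rule dvd_det_diff) (simp add: EE eps_square_dvd_iff)
    ultimately show ?thesis
      using dvd_mult_diff[of "[:0, 0, 1:]" "det (mat 1 - E N ** E N)" 1 "det (I M)" "det (I M)"]
      by simp
  qed
  ultimately have "[:0, 0, 1:] dvd det T - det (I M)"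
    by (rule dvd_diff_trans)
  then have "[:0, 0, 1:] dvd [:det M, d (det M):] - det (I M)"
    using eps_det[OF d, of M] unfolding T_def by (rule dvd_diff_trans[rotated])
  \<comment> \<open>The zero map is a derivation too, and for it \<open>eps_det\<close> compares the
    determinant of \<open>I M\<close> with that of \<open>M\<close>.\<close>
  moreover have "[:0, 0, 1:] dvd det (I M) - [:det M, 0:]"
    using eps_det[of "\<lambda>_. 0" M] dvd_minus_iff[of "[:0, 0, 1:]" "[:det M, 0:] - det (I M)"]
    by (simp add: derivation_def I_def)
  ultimately have "[:0, 0, 1:] dvd [:det M, d (det M):] - [:det M, 0:]"
    by (rule dvd_diff_trans)
  then show ?thesis
    by (simp add: eps_square_dvd_iff)
qed

subsection \<open>Reduction of operators\<close>

text \<open>This is the map \<open>\<rho>\<close> of the overview. Operators keep coefficients in K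
  and only the values involve \<open>\<lambda>\<close> and \<open>\<mu>\<close>, so commutation over
  K applies directly. \<open>N\<close> is arbitrary until \<open>reduce_commuting\<close>.\<close>

definition reduce :: "('a::comm_ring_1 \<Rightarrow> 'a) \<Rightarrow> 'a poly poly^'n::finite^'n \<Rightarrow> ('a, 'n) matrix_op
    \<Rightarrow> 'a poly poly^'n^'n" where
  "reduce d N Q = (\<Sum>j\<le>degree Q. map_matrix const2 (coeff Q j) ** red_poly (deriv2 d) N j)"

lemma map_matrix_const2_0: "map_matrix const2 0 = 0"
  by (simp add: vec_eq_iff const2_simps)

lemma map_matrix_const2_add: "map_matrix const2 (A + B) = map_matrix const2 A + map_matrix const2 B"
  by (simp add: vec_eq_iff const2_simps)

lemma const2_sum: "const2 (sum f S) = (\<Sum>x\<in>S. const2 (f x))"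
  by (induction S rule: infinite_finite_induct) (simp_all add: const2_simps)

lemma map_matrix_const2_mult:
  "map_matrix const2 (A ** B) = map_matrix const2 A ** map_matrix const2 B"
  by (simp add: vec_eq_iff matrix_matrix_mult_def const2_sum const2_simps)

text \<open>Operators of different degrees can be compared once their sums run to a common
  bound.\<close>

lemma reduce_eq_sum:
  assumes "degree Q \<le> n"
  shows "reduce d N Q = (\<Sum>j\<le>n. map_matrix const2 (coeff Q j) ** red_poly (deriv2 d) N j)"
  unfolding reduce_def using assms
  by (intro sum.mono_neutral_left)
    (auto simp: coeff_eq_0 map_matrix_const2_0 matrix_mul_zero)

lemma reduce_add: "reduce d N (P + Q) = reduce d N P + reduce d N Q"
proof -
  define n where "n = max (degree P) (degree Q)"
  have "degree P \<le> n" "degree Q \<le> n" "degree (P + Q) \<le> n"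
    unfolding n_def by (simp_all add: degree_add_le_max)
  then show ?thesis
    by (simp add: reduce_eq_sum[where n = n] map_matrix_const2_add matrix_add_rdistrib sum.distrib)
qed

lemma reduce_0: "reduce d N 0 = 0"
  by (simp add: reduce_def map_matrix_const2_0 matrix_mul_zero)

lemma reduce_sum: "reduce d N (sum f S) = (\<Sum>x\<in>S. reduce d N (f x))"
  by (induction S rule: infinite_finite_induct) (simp_all add: reduce_0 reduce_add)

lemma reduce_matrix_mult:
  "reduce d N (map_poly (\<lambda>B. A ** B) Q) = map_matrix const2 A ** reduce d N Q"
proof -
  have "degree (map_poly (\<lambda>B. A ** B) Q) \<le> degree Q"
    by (rule map_poly_degree_leq)
  then show ?thesis
    by (simp add: reduce_eq_sum[where n = "degree Q"] coeff_map_poly matrix_mul_zero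
        map_matrix_const2_mult matrix_sum_ldistrib matrix_mul_assoc)
qed

text \<open>The product rule splits the derivative of each term of \<open>reduce d N Q\<close>; the
  part differentiating \<open>red_poly\<close> joins the term from right multiplication by
  \<open>N\<close> to form the next \<open>red_poly\<close>.\<close>

lemma reduce_D_times:
  assumes "derivation d"
  shows "reduce d N (D_times d Q) = map_matrix (deriv2 d) (reduce d N Q) + reduce d N Q ** N"
proof -
  have z: "map_matrix d (0 :: 'a^'n^'n) = 0"
    by (simp add: vec_eq_iff derivation_0[OF assms])
  have c: "map_matrix const2 (map_matrix d A) = map_matrix (deriv2 d) (map_matrix const2 A)"
    for A :: "'a^'n^'n"
    by (simp add: vec_eq_iff deriv2_const2[OF assms])
  have "degree (map_poly (map_matrix d) Q) \<le> degree Q"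
    by (rule map_poly_degree_leq)
  then have 1: "reduce d N (map_poly (map_matrix d) Q) =
      (\<Sum>j\<le>degree Q. map_matrix (deriv2 d) (map_matrix const2 (coeff Q j)) ** red_poly (deriv2 d) N j)"
    by (simp add: reduce_eq_sum[where n = "degree Q"] coeff_map_poly z c)
  have 2: "reduce d N (pCons 0 Q) =
      (\<Sum>j\<le>degree Q. map_matrix const2 (coeff Q j) ** red_poly (deriv2 d) N (Suc j))"
    by (subst reduce_eq_sum[where n = "Suc (degree Q)"])
      (simp_all add: degree_pCons_le sum.atMost_Suc_shift map_matrix_const2_0 matrix_mul_zero
        del: sum.atMost_Suc)
  show ?thesis
    unfolding D_times_def reduce_add 1 2
    by (simp add: reduce_def map_matrix_derivation_sum[OF derivation_deriv2[OF assms]]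
        map_matrix_derivation_mult[OF derivation_deriv2[OF assms]] matrix_sum_rdistrib
        matrix_add_ldistrib matrix_mul_assoc sum.distrib add_ac)
qed

lemma op_mult_eq_sum:
  fixes P Q :: "('a::comm_ring_1, 'n::finite) matrix_op"
  assumes "degree P \<le> n"
  shows "op_mult d P Q = (\<Sum>i\<le>n. map_poly (\<lambda>B. coeff P i ** B) ((D_times d ^^ i) Q))"
proof -
  have "map_poly (\<lambda>B. coeff P i ** B) R = 0" if "degree P < i"
    for i and R :: "('a, 'n) matrix_op"
    using that by (intro poly_eqI) (simp add: coeff_map_poly coeff_eq_0 matrix_mul_zero)
  then show ?thesis
    unfolding op_mult_def using assms
    by (intro sum.mono_neutral_left) (auto simp flip: not_less)
qed

lemma reduce_op_mult:
  assumes "degree P \<le> n"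
  shows "reduce d N (op_mult d P Q) =
    (\<Sum>i\<le>n. map_matrix const2 (coeff P i) ** reduce d N ((D_times d ^^ i) Q))"
  by (simp add: op_mult_eq_sum[OF assms] reduce_sum reduce_matrix_mult)

text \<open>A constant scalar matrix passes through X' + X N, leaving the recursion of
  \<open>red_poly\<close>. It is used with \<open>Q\<close> = L and \<open>c\<close> =
  \<open>\<lambda>\<close>.\<close>

lemma reduce_D_times_funpow:
  assumes "derivation d" "deriv2 d c = 0" "reduce d N Q = mat c"
  shows "reduce d N ((D_times d ^^ i) Q) = mat c ** red_poly (deriv2 d) N i"
proof (induction i)
  case (Suc i)
  then show ?case
    by (simp add: reduce_D_times[OF assms(1)] matrix_add_ldistrib matrix_mul_assoc
        map_matrix_derivation_mult[OF derivation_deriv2[OF assms(1)]] matrix_mul_zero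
        map_matrix_derivation_mat[OF derivation_deriv2[OF assms(1)] assms(2)] add.commute)
qed (simp add: assms)

lemma reduce_commuting:
  assumes d: "derivation d" and inv: "invertible A1"
    and comm: "op_mult d [:A0, A1:] B = op_mult d B [:A0, A1:]"
    and N: "N = - (map_matrix const2 (matrix_inv A1) ** (map_matrix const2 A0 - mat var_lambda))"
  shows "map_matrix (deriv2 d) (reduce d N B) = N ** reduce d N B - reduce d N B ** N"
proof -
  let ?h = "map_matrix const2" and ?R = "reduce d N B" and ?l = "mat var_lambda"
  have "A1 ** matrix_inv A1 = mat 1 \<and> matrix_inv A1 ** A1 = mat 1"
    using inv unfolding invertible_def matrix_inv_def by (rule someI_ex)
  moreover have "?h (mat 1) = mat 1"
    by (simp add: vec_eq_iff mat_def const2_simps)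
  ultimately have i: "?h A1 ** ?h (matrix_inv A1) = mat 1" "?h (matrix_inv A1) ** ?h A1 = mat 1"
    by (simp_all flip: map_matrix_const2_mult)
  have deg: "degree [:A0, A1:] \<le> 1"
    by simp
  \<comment> \<open>By the choice of \<open>N\<close>, A0 + A1 N = A0 - (A0 -
    \<open>\<lambda>\<close>).\<close>
  have L: "reduce d N [:A0, A1:] = ?l"
    by (subst reduce_eq_sum[OF deg])
      (simp add: derivation_1[OF derivation_deriv2[OF d]]
        map_matrix_derivation_mat[OF derivation_deriv2[OF d]] N matrix_minus_right matrix_mul_assoc i)
  have "?h A0 ** ?R + ?h A1 ** (map_matrix (deriv2 d) ?R + ?R ** N) = reduce d N (op_mult d [:A0, A1:] B)"
    by (simp add: reduce_op_mult[OF deg] reduce_D_times[OF d])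
  \<comment> \<open>After replacing L B by B L, every D^i L reduces to \<open>\<lambda>\<close>
    times \<open>red_poly\<close>, and the central scalar factors out.\<close>
  also have "\<dots> = ?l ** ?R"
    by (simp add: comm reduce_op_mult[OF order.refl] reduce_D_times_funpow[OF d deriv2_var(1)[OF d] L])
      (simp add: reduce_def matrix_sum_ldistrib mat_left_commute)
  finally have "?h A1 ** (map_matrix (deriv2 d) ?R + ?R ** N) = - ((?h A0 - ?l) ** ?R)"
    by (simp add: matrix_diff_rdistrib algebra_simps)
  \<comment> \<open>Cancelling A1 on the left isolates R' + R N = N R.\<close>
  then have "?h (matrix_inv A1) ** (?h A1 ** (map_matrix (deriv2 d) ?R + ?R ** N)) = N ** ?R"
    by (simp add: N matrix_minus_left matrix_minus_right matrix_mul_assoc)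
  then show ?thesis
    by (simp add: matrix_mul_assoc i algebra_simps)
qed

theorem theoremB:
  fixes d :: "'a::field_char_0 \<Rightarrow> 'a"
    and A0 A1 :: "'a^'n::finite^'n"
    and L B :: "('a, 'n) matrix_op"
  assumes "derivation d"
    and "algebraically_closed_subfield (constants d)"
    and "L = [:A0, A1:]"
    and "invertible A1"
    and "op_mult d L B = op_mult d B L"
  shows "DRes (deriv2 d) (minus_scalar L var_lambda) (minus_scalar B var_mu)
           \<in> polys_over (polys_over (constants d))"
proof -
  note d2 = derivation_deriv2[OF assms(1)]
  define N where "N = - (map_matrix const2 (matrix_inv A1) ** (map_matrix const2 A0 - mat var_lambda))"
  let ?M = "reduce d N B - mat var_mu"
  \<comment> \<open>\<open>red_matrix\<close> keeps the term of index 0 apart; it joins the sum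
    because \<open>red_poly\<close> starts at the identity.\<close>
  have "red_matrix (deriv2 d) (minus_scalar L var_lambda) (minus_scalar B var_mu) = ?M"
    unfolding assms(3) red_matrix_minus_scalar[OF assms(4)] N_def[symmetric]
    by (simp add: reduce_def atMost_atLeast0 sum.atLeast_Suc_atMost)
  \<comment> \<open>\<open>\<mu>\<close> is constant and its scalar matrix central, so subtracting
    it preserves the Lax equation.\<close>
  moreover have "map_matrix (deriv2 d) ?M = N ** ?M - ?M ** N"
    using reduce_commuting[OF assms(1,4) _ N_def] assms(3,5)
    by (simp add: map_matrix_derivation_diff[OF d2] map_matrix_derivation_mat[OF d2 deriv2_var(2)[OF assms(1)]]
        matrix_diff_ldistrib matrix_diff_rdistrib mat_commute)
  ultimately show ?thesis
    using derivation_det_Lax[OF d2] by (simp add: DRes_def flip: deriv2_eq_0_iff[OF assms(1)])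
qed

end
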